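(* Let $m\ge 1$, $L\in GL(m,\mathbb{R})$ and $\varepsilon>0$, and let $L_\varepsilon:\mathcal{K}(\mathbb{R}^m)\to\mathcal{K}(\mathbb{R}^m)$, $L_\varepsilon(C)=\{x+y \mid x\in L(C),\ \|y\|\le\varepsilon\}$. Then $L_\varepsilon$ has a fixed point $A\in\mathcal{K}(\mathbb{R}^m)$ (that is, $L_\varepsilon(A)=A$) if and only if all (complex) eigenvalues of $L$ have magnitude less than $1$. The fixed point $A$ (when it exists) is unique and globally attracting for $L_\varepsilon$.
   Context: $\mathcal{K}(\mathbb{R}^m)$ is the space of non-empty compact subsets of $\mathbb{R}^m$, equipped with the Hausdorff metric $d_H(A,B)=\max\{\sup_{x\in A}\inf_{y\in B}d(x,y),\ \sup_{y\in B}\inf_{x\in A}d(x,y)\}$, where $d$ is the Euclidean metric and $\|\cdot\|$ the Euclidean norm. For $C\in\mathcal{K}(\mathbb{R}^m)$, $L(C)=\{L(x)\mid x\in C\}$. A fixed point $A$ of $L_\varepsilon$ is called globally attracting if $\lim_{i\to\infty}L_\varepsilon^i(C)=A$ in the Hausdorff metric for all $C\in\mathcal{K}(\mathbb{R}^m)$. *)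

theory Defs
  imports "HOL-Analysis.Analysis"
begin

definition nonempty_compacts :: "'a::metric_space set set"  ("\<K>")
  where "\<K> = {C. compact C \<and> C \<noteq> {}}"

text \<open>On \<open>\<K>\<close> all the suprema and infima are over bounded non-empty sets of reals;
  no meaning is attached to the value outside \<open>\<K>\<close>.\<close>

definition hausdorff_dist :: "'a::metric_space set \<Rightarrow> 'a set \<Rightarrow> real"
  where "hausdorff_dist A B =
    max (SUP x\<in>A. INF y\<in>B. dist x y) (SUP y\<in>B. INF x\<in>A. dist x y)"

definition inflated_map :: "real^'m^'m \<Rightarrow> real \<Rightarrow> (real^'m) set \<Rightarrow> (real^'m) set"
  where "inflated_map L \<epsilon> C = {x + y | x y. x \<in> (\<lambda>z. L *v z) ` C \<and> norm y \<le> \<epsilon>}"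

lemma inflated_map_in_nonempty_compacts:
  assumes "C \<in> \<K>" and "\<epsilon> > 0"
  shows "inflated_map L \<epsilon> C \<in> \<K>"
proof -
  have "compact ((\<lambda>z. L *v z) ` C)"
    using assms(1) by (intro compact_continuous_image)
      (auto simp: nonempty_compacts_def intro!: linear_continuous_on matrix_vector_mul_bounded_linear)
  then have "compact {x + y | x y. x \<in> (\<lambda>z. L *v z) ` C \<and> y \<in> cball 0 \<epsilon>}"
    by (intro compact_sums compact_cball)
  moreover have "inflated_map L \<epsilon> C \<noteq> {}"
  proof -
    obtain z where "z \<in> C" using assms(1) by (auto simp: nonempty_compacts_def)
    then have "L *v z + 0 \<in> inflated_map L \<epsilon> C"
      using assms(2) unfolding inflated_map_def by (intro CollectI exI[of _ "L *v z"] exI[of _ 0]) auto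
    then show ?thesis by blast
  qed
  ultimately show ?thesis
    by (simp add: nonempty_compacts_def inflated_map_def)
qed

definition globally_attracting ::
    "('a::metric_space set \<Rightarrow> 'a set) \<Rightarrow> 'a set \<Rightarrow> bool"
  where "globally_attracting F A \<longleftrightarrow>
    (\<forall>C\<in>\<K>. (\<lambda>i. hausdorff_dist ((F ^^ i) C) A) \<longlonglongrightarrow> 0)"

text \<open>Eigenvalues of a real matrix acting on the complexification of \<open>\<real>\<^sup>m\<close>;
  \<open>*s\<close> is scalar multiplication by a complex number.\<close>

definition complex_eigenvalue :: "real^'m^'m \<Rightarrow> complex \<Rightarrow> bool"
  where "complex_eigenvalue L \<mu> \<longleftrightarrow>
    (\<exists>v :: complex^'m. v \<noteq> 0 \<and> (\<chi> i j. complex_of_real (L $ i $ j)) *v v = \<mu> *s v)"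

end

theory Submission
  imports Defs "HOL-Computational_Algebra.Fundamental_Theorem_Algebra"
begin

text \<open>
  Suppose first that \<open>A\<close> is a non-empty compact fixed set and that \<open>\<mu>\<close> is an eigenvalue.  As \<open>\<mu>\<close> is
  also an eigenvalue of the transpose, there is a non-zero real-linear functional
  \<open>f : \<real>\<^sup>m \<Rightarrow> \<complex>\<close> with \<open>f (L x) = \<mu> f x\<close>.  Let \<open>\<bar>f\<bar>\<close> attain its maximum over \<open>A\<close> at \<open>x\<close>.  Both
  \<open>L x + y\<close> and \<open>L x - y\<close> lie in \<open>A\<close> for every \<open>y\<close> of norm \<open>\<epsilon>\<close>, and by the parallelogram law \<open>\<bar>f\<bar>\<close>
  exceeds \<open>\<bar>\<mu> f x\<bar>\<close> at one of these two points once \<open>f y \<noteq> 0\<close>.  Maximality then forces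
  \<open>\<bar>\<mu>\<bar> < 1\<close> (\<open>eigenvalue_less_1_if_fixed_set\<close>).

  Suppose now that all eigenvalues have modulus below one.  Then every orbit \<open>L\<^sup>n x\<close> is absolutely
  summable.  This is shown without any normal form: some non-zero complex polynomial in \<open>L\<close>
  annihilates \<open>x\<close>, and its roots are split off one at a time (\<open>summable_orbit_if_annihilated\<close>).
  Hence \<open>\<parallel>L\<^sup>n x\<parallel> \<le> K n * \<parallel>x\<parallel>\<close> with a summable sequence \<open>K\<close>.
  The iterates of \<open>{0}\<close> under the inflated map increase and stay within the ball of radius
  \<open>\<epsilon> * (\<Sum>n. K n)\<close>, so the closure of their union is a compact fixed set
  (\<open>fixed_set_exists\<close>).

  Any point of the \<open>n\<close>-th iterate of \<open>C\<close> is shadowed, using the same perturbations, by a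
  point of the \<open>n\<close>-th iterate of \<open>B\<close>, with the two points differing by \<open>L\<^sup>n (c - b)\<close>
  (\<open>inflated_map_iterates_shadow\<close>).  A fixed set already forces the eigenvalues below one, so \<open>K\<close> is
  available and tends to zero; hence a fixed set is unique (\<open>fixed_set_subset\<close>) and globally
  attracting (\<open>fixed_set_globally_attracting\<close>).
\<close>

section \<open>Fixed sets force small eigenvalues\<close>

lemma mat_mult_vec: "mat c *v x = c *s (x :: 'a::semiring_1^'n)"
  by (simp add: vec_eq_iff matrix_vector_mult_def mat_def if_distrib if_distribR cong: if_cong)

lemma eigenvalue_transpose:
  fixes M :: "'a::field^'n^'n"
  assumes "v \<noteq> 0" and "M *v v = \<mu> *s v"
  shows "\<exists>w. w \<noteq> 0 \<and> transpose M *v w = \<mu> *s w"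
proof -
  have "(M - mat \<mu>) *v v = 0"
    using assms by (simp add: matrix_vector_mult_diff_rdistrib mat_mult_vec)
  then have "\<not> invertible (M - mat \<mu>)"
    using assms(1) matrix_left_invertible_ker invertible_left_inverse by blast
  then have "\<not> invertible (transpose (M - mat \<mu>))"
    by (simp add: invertible_det_nz det_transpose)
  then obtain w where "w \<noteq> 0" "transpose (M - mat \<mu>) *v w = 0"
    using matrix_left_invertible_ker invertible_left_inverse by blast
  moreover have "transpose (M - mat \<mu>) = transpose M - mat \<mu>"
    by (simp add: vec_eq_iff transpose_def mat_def)
  ultimately show ?thesis
    by (auto simp: matrix_vector_mult_diff_rdistrib mat_mult_vec)
qed

text \<open>A left eigenvector, read as a functional on the real space: on this functional \<open>L\<close> acts as
  multiplication by \<open>\<mu>\<close>.\<close>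

lemma eigenfunctional_exists:
  fixes L :: "real^'m^'m"
  assumes "complex_eigenvalue L \<mu>"
  obtains f :: "real^'m \<Rightarrow> complex" and y
  where "linear f" and "\<And>x. f (L *v x) = \<mu> * f x" and "norm y = 1" and "f y \<noteq> 0"
proof -
  let ?M = "(\<chi> i j. complex_of_real (L $ i $ j)) :: complex^'m^'m"
  obtain w where "w \<noteq> 0" and w: "transpose ?M *v w = \<mu> *s w"
    using assms eigenvalue_transpose unfolding complex_eigenvalue_def by blast
  define f where "f x = (\<Sum>j\<in>UNIV. w $ j * complex_of_real (x $ j))" for x :: "real^'m"
  have "linear f"
    by (rule linearI)
      (simp_all add: f_def sum.distrib ring_distribs scaleR_conv_of_real[where 'a = complex]
        sum_distrib_left ac_simps)
  moreover have "f (L *v x) = \<mu> * f x" for x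
  proof -
    have "f (L *v x) = (\<Sum>j\<in>UNIV. \<Sum>k\<in>UNIV. w $ j * (of_real (L $ j $ k) * of_real (x $ k)))"
      by (simp add: f_def matrix_vector_mult_def sum_distrib_left)
    also have "\<dots> = (\<Sum>k\<in>UNIV. (transpose ?M *v w) $ k * of_real (x $ k))"
      by (subst sum.swap)
        (simp add: matrix_vector_mult_def transpose_def sum_distrib_left sum_distrib_right ac_simps)
    also have "\<dots> = \<mu> * f x"
      unfolding w by (simp add: f_def sum_distrib_left ac_simps)
    finally show ?thesis .
  qed
  moreover obtain j where "w $ j \<noteq> 0"
    using \<open>w \<noteq> 0\<close> by (auto simp: vec_eq_iff)
  then have "f (axis j 1) \<noteq> 0"
    by (simp add: f_def axis_def if_distrib cong: if_cong)
  ultimately show thesis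
    using that[of f "axis j 1"] by simp
qed

lemma parallelogram_law:
  fixes a b :: "'a::real_inner"
  shows "(norm (a + b))\<^sup>2 + (norm (a - b))\<^sup>2 = 2 * (norm a)\<^sup>2 + 2 * (norm b)\<^sup>2"
  by (simp add: power2_norm_eq_inner inner_simps inner_commute)

lemma inflated_mapI:
  "x \<in> C \<Longrightarrow> norm y \<le> \<epsilon> \<Longrightarrow> L *v x + y \<in> inflated_map L \<epsilon> C"
  unfolding inflated_map_def by blast

lemma inflated_mapE:
  assumes "z \<in> inflated_map L \<epsilon> C"
  obtains x y where "x \<in> C" "norm y \<le> \<epsilon>" "z = L *v x + y"
  using assms unfolding inflated_map_def by blast

lemma eigenvalue_less_1_if_fixed_set:
  assumes "A \<in> \<K>" and fixed: "inflated_map L \<epsilon> A = A" and "\<epsilon> > 0"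
    and "complex_eigenvalue L \<mu>"
  shows "cmod \<mu> < 1"
proof (rule ccontr)
  assume "\<not> cmod \<mu> < 1"
  obtain f y0 where f: "linear f" "\<And>x. f (L *v x) = \<mu> * f x" and y0: "norm y0 = 1" "f y0 \<noteq> 0"
    using eigenfunctional_exists[OF assms(4)] by metis
  have "continuous_on A (\<lambda>x. cmod (f x))"
    by (intro continuous_on_norm linear_continuous_on linear_conv_bounded_linear[THEN iffD1] f)
  then obtain x where "x \<in> A" and max: "\<And>z. z \<in> A \<Longrightarrow> cmod (f z) \<le> cmod (f x)"
    using continuous_attains_sup[of A "\<lambda>x. cmod (f x)"] \<open>A \<in> \<K>\<close>
    by (auto simp: nonempty_compacts_def)
  define y where "y = \<epsilon> *\<^sub>R y0"
  have "f y \<noteq> 0"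
    using f(1) y0 \<open>\<epsilon> > 0\<close> by (simp add: y_def linear_cmul)
  have "L *v x + y \<in> A" "L *v x + (- y) \<in> A"
    using inflated_mapI[OF \<open>x \<in> A\<close>, of y \<epsilon> L] inflated_mapI[OF \<open>x \<in> A\<close>, of "- y" \<epsilon> L]
      y0 \<open>\<epsilon> > 0\<close> by (simp_all add: fixed y_def)
  then have "cmod (\<mu> * f x + f y) \<le> cmod (f x)" "cmod (\<mu> * f x - f y) \<le> cmod (f x)"
    using max[of "L *v x + y"] max[of "L *v x + (- y)"] f
    by (simp_all add: linear_add linear_diff)
  then have "(cmod (\<mu> * f x + f y))\<^sup>2 + (cmod (\<mu> * f x - f y))\<^sup>2 \<le> 2 * (cmod (f x))\<^sup>2"
    by (smt (verit) norm_ge_zero power_mono)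
  then have "(cmod (\<mu> * f x))\<^sup>2 + (cmod (f y))\<^sup>2 \<le> (cmod (f x))\<^sup>2"
    by (simp add: parallelogram_law)
  moreover have "cmod (f x) \<le> cmod (\<mu> * f x)"
    using \<open>\<not> cmod \<mu> < 1\<close> by (simp add: norm_mult mult_le_cancel_right1)
  then have "(cmod (f x))\<^sup>2 \<le> (cmod (\<mu> * f x))\<^sup>2"
    by (simp add: power_mono)
  moreover have "(cmod (f y))\<^sup>2 > 0"
    using \<open>f y \<noteq> 0\<close> by simp
  ultimately show False by linarith
qed


section \<open>Small eigenvalues make orbits summable\<close>

text \<open>The vector \<open>p(M) v\<close>, evaluated by Horner's scheme, so that induction over \<open>pCons\<close> applies.\<close>

definition poly_apply :: "complex poly \<Rightarrow> complex^'m^'m \<Rightarrow> complex^'m \<Rightarrow> complex^'m"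
  where "poly_apply p M v = fold_coeffs (\<lambda>c w. c *s v + M *v w) p 0"

lemma poly_apply_0 [simp]: "poly_apply 0 M v = 0"
  by (simp add: poly_apply_def)

lemma poly_apply_pCons [simp]: "poly_apply (pCons c p) M v = c *s v + M *v poly_apply p M v"
  by (cases "p = 0 \<and> c = 0") (auto simp: poly_apply_def)

lemma poly_apply_add: "poly_apply (p + q) M v = poly_apply p M v + poly_apply q M v"
  by (induction p q rule: poly_induct2)
    (simp_all add: vector_sadd_rdistrib matrix_vector_right_distrib)

lemma poly_apply_smult: "poly_apply (smult c p) M v = c *s poly_apply p M v"
  by (induction p) (simp_all add: vector_add_ldistrib vector_smult_assoc vector_scalar_commute)

lemma poly_apply_sum: "poly_apply (\<Sum>i\<in>I. p i) M v = (\<Sum>i\<in>I. poly_apply (p i) M v)"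
  by (induction I rule: infinite_finite_induct) (simp_all add: poly_apply_add)

lemma poly_apply_monom: "poly_apply (monom c n) M v = c *s (((*v) M ^^ n) v)"
  by (induction n) (simp_all add: monom_0 monom_Suc vector_scalar_commute)

lemma poly_apply_linear_factor:
  "poly_apply ([:- a, 1:] * p) M v = M *v poly_apply p M v - a *s poly_apply p M v"
proof -
  have "[:- a, 1:] * p = smult (- a) p + pCons 0 p" by simp
  then show ?thesis
    by (simp only: poly_apply_add poly_apply_smult) (simp add: vector_smult_lneg)
qed

lemma poly_apply_commute:
  "poly_apply p M (M *v v - a *s v) = M *v poly_apply p M v - a *s poly_apply p M v"
proof (induction p)
  case (pCons c p)
  have "poly_apply (pCons c p) M (M *v v - a *s v)
      = c *s (M *v v - a *s v) + M *v (M *v poly_apply p M v - a *s poly_apply p M v)"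
    by (simp add: pCons.IH)
  also have "\<dots> = M *v (c *s v + M *v poly_apply p M v) - a *s (c *s v + M *v poly_apply p M v)"
    by (simp add: vector_scalar_commute matrix_vector_right_distrib vector_ssub_ldistrib
      matrix_vector_mult_diff_distrib vector_add_ldistrib vector_smult_assoc mult.commute)
  finally show ?case by simp
qed simp

text \<open>The first \<open>m + 1\<close> points of an orbit in \<open>\<complex>\<^sup>m\<close> are either not distinct or linearly
  dependent; both cases give an annihilating polynomial.\<close>

lemma annihilating_poly_exists:
  fixes M :: "complex^'m^'m"
  shows "\<exists>p. p \<noteq> 0 \<and> poly_apply p M v = 0"
proof -
  let ?o = "\<lambda>n. ((*v) M ^^ n) v"
  let ?I = "{..CARD('m)}"
  show ?thesis
  proof (cases "inj_on ?o ?I")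
    case True
    have "vec.dim (?o ` ?I) \<le> CARD('m)"
      by (rule dim_subset_UNIV_cart_gen)
    then have "vec.dependent (?o ` ?I)"
      by (intro vec.dependent_biggerset_general) (simp add: card_image[OF True])
    then obtain u where u: "\<exists>x\<in>?o ` ?I. u x \<noteq> 0" "(\<Sum>x\<in>?o ` ?I. u x *s x) = 0"
      using vec.dependent_finite[of "?o ` ?I"] by blast
    define p where "p = (\<Sum>i\<in>?I. monom (u (?o i)) i)"
    have "poly_apply p M v = (\<Sum>i\<in>?I. u (?o i) *s ?o i)"
      by (simp add: p_def poly_apply_sum poly_apply_monom)
    then have "poly_apply p M v = 0"
      using u(2) by (simp add: sum.reindex[OF True])
    moreover obtain j where "j \<in> ?I" "u (?o j) \<noteq> 0"
      using u(1) by auto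
    then have "coeff p j \<noteq> 0"
      by (simp add: p_def coeff_sum)
    then have "p \<noteq> 0" by auto
    ultimately show ?thesis by blast
  next
    case False
    then obtain i j where "i \<noteq> j" "?o i = ?o j"
      unfolding inj_on_def by blast
    define p where "p = monom (1::complex) i + monom (- 1) j"
    have "poly_apply p M v = 0"
      using \<open>?o i = ?o j\<close> by (simp add: p_def poly_apply_add poly_apply_monom)
    moreover have "coeff p i = 1"
      using \<open>i \<noteq> j\<close> by (simp add: p_def)
    then have "p \<noteq> 0" by auto
    ultimately show ?thesis by blast
  qed
qed

lemma summable_if_contracting_recurrence:
  fixes x e :: "nat \<Rightarrow> real"
  assumes "\<And>n. 0 \<le> x n" and "\<And>n. 0 \<le> e n" and "summable e" and "r < 1"
    and "\<And>n. x (Suc n) \<le> r * x n + e n"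
  shows "summable x"
proof (rule summableI_nonneg_bounded)
  fix n
  have "(\<Sum>i<n. x i) \<le> (\<Sum>i<Suc n. x i)"
    using assms(1) by simp
  also have "\<dots> = x 0 + (\<Sum>i<n. x (Suc i))"
    by (rule sum.lessThan_Suc_shift)
  also have "\<dots> \<le> x 0 + (\<Sum>i<n. r * x i + e i)"
    using assms(5) by (intro add_left_mono sum_mono)
  also have "\<dots> = x 0 + r * (\<Sum>i<n. x i) + (\<Sum>i<n. e i)"
    by (simp add: sum.distrib sum_distrib_left)
  also have "\<dots> \<le> x 0 + r * (\<Sum>i<n. x i) + suminf e"
    using assms by (intro add_left_mono sum_le_suminf) auto
  finally have "(\<Sum>i<n. x i) * (1 - r) \<le> x 0 + suminf e"
    by (simp add: algebra_simps)
  then show "(\<Sum>i<n. x i) \<le> (x 0 + suminf e) / (1 - r)"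
    using \<open>r < 1\<close> by (simp add: pos_le_divide_eq)
qed (fact assms(1))

lemma funpow_matrix_diff:
  fixes M :: "'a::field^'m^'m"
  shows "((*v) M ^^ n) (v - w) = ((*v) M ^^ n) v - ((*v) M ^^ n) w"
  by (induction n) (simp_all add: matrix_vector_mult_diff_distrib)

lemma funpow_matrix_scale:
  fixes M :: "'a::field^'m^'m"
  shows "((*v) M ^^ n) (c *s v) = c *s ((*v) M ^^ n) v"
  by (induction n) (simp_all add: vector_scalar_commute)

lemma norm_smult_vec: "norm (c *s (v :: complex^'m)) = cmod c * norm v"
  by (simp add: norm_vec_def norm_mult L2_set_right_distrib)

text \<open>Split a root \<open>a\<close> off \<open>p = (X - a) q\<close> and put \<open>w = q(M) v\<close>.  If \<open>w = 0\<close>, the polynomial \<open>q\<close>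
  already annihilates \<open>v\<close>.  Otherwise \<open>w\<close> is an eigenvector for \<open>a\<close>, so \<open>\<bar>a\<bar> < 1\<close>; moreover \<open>q\<close>
  annihilates \<open>u = M v - a v\<close>, whose orbit is the error term in the contracting recurrence
  \<open>M\<^sup>n\<^sup>+\<^sup>1 v = a M\<^sup>n v + M\<^sup>n u\<close>.\<close>

lemma summable_orbit_if_annihilated:
  fixes M :: "complex^'m^'m"
  assumes eig: "\<And>\<mu> w. w \<noteq> 0 \<Longrightarrow> M *v w = \<mu> *s w \<Longrightarrow> cmod \<mu> < 1"
  shows "p \<noteq> 0 \<Longrightarrow> poly_apply p M v = 0 \<Longrightarrow> summable (\<lambda>n. norm (((*v) M ^^ n) v))"
proof (induction "degree p" arbitrary: p v)
  case 0
  obtain c where "p = [:c:]"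
    using degree_eq_zeroE[OF 0(1)[symmetric]] .
  then have "v = 0" using 0(2,3) by simp
  moreover have "((*v) M ^^ n) 0 = 0" for n
    by (induction n) simp_all
  ultimately show ?case by simp
next
  case (Suc d)
  have "\<not> constant (poly p)"
    using Suc.hyps(2) by (simp add: constant_degree)
  then obtain a where "poly p a = 0"
    using fundamental_theorem_of_algebra by blast
  then obtain q where q: "p = [:- a, 1:] * q"
    unfolding poly_eq_0_iff_dvd by (elim dvdE)
  have "q \<noteq> 0" using q Suc.prems(1) by auto
  moreover have "degree p = Suc (degree q)"
    unfolding q using \<open>q \<noteq> 0\<close> by (subst degree_mult_eq) auto
  ultimately have IH: "poly_apply q M u = 0 \<Longrightarrow> summable (\<lambda>n. norm (((*v) M ^^ n) u))" for u
    using Suc.hyps(1)[of q u] Suc.hyps(2) by simp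
  let ?w = "poly_apply q M v"
  have w: "M *v ?w - a *s ?w = 0"
    using Suc.prems(2) unfolding q poly_apply_linear_factor .
  show ?case
  proof (cases "?w = 0")
    case True
    then show ?thesis by (rule IH)
  next
    case False
    define u where "u = M *v v - a *s v"
    have "cmod a < 1"
      using eig[OF False, of a] w by simp
    have u: "summable (\<lambda>n. norm (((*v) M ^^ n) u))"
      using w by (intro IH) (simp add: u_def poly_apply_commute)
    have step: "norm (((*v) M ^^ Suc n) v)
        \<le> cmod a * norm (((*v) M ^^ n) v) + norm (((*v) M ^^ n) u)" for n
    proof -
      have "((*v) M ^^ Suc n) v = a *s ((*v) M ^^ n) v + ((*v) M ^^ n) u"
        unfolding funpow_Suc_right o_def u_def
        by (simp add: funpow_matrix_diff funpow_matrix_scale)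
      then show ?thesis
        by (metis norm_smult_vec norm_triangle_ineq)
    qed
    show ?thesis
      by (rule summable_if_contracting_recurrence[OF _ _ u \<open>cmod a < 1\<close> step]) simp_all
  qed
qed

lemma summable_real_orbit:
  fixes L :: "real^'m^'m"
  assumes "\<And>\<mu>. complex_eigenvalue L \<mu> \<Longrightarrow> cmod \<mu> < 1"
  shows "summable (\<lambda>n. norm (((*v) L ^^ n) x))"
proof -
  let ?M = "(\<chi> i j. complex_of_real (L $ i $ j)) :: complex^'m^'m"
  let ?c = "\<lambda>x :: real^'m. (\<chi> i. complex_of_real (x $ i)) :: complex^'m"
  have "?M *v ?c x = ?c (L *v x)" for x
    by (simp add: vec_eq_iff matrix_vector_mult_def)
  then have "((*v) ?M ^^ n) (?c x) = ?c (((*v) L ^^ n) x)" for n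
    by (induction n) simp_all
  moreover have "norm (?c x) = norm x" for x
    by (simp add: norm_vec_def)
  ultimately have "(\<lambda>n. norm (((*v) L ^^ n) x)) = (\<lambda>n. norm (((*v) ?M ^^ n) (?c x)))"
    by simp
  moreover obtain p where "p \<noteq> 0" "poly_apply p ?M (?c x) = 0"
    using annihilating_poly_exists by blast
  then have "summable (\<lambda>n. norm (((*v) ?M ^^ n) (?c x)))"
    using assms by (intro summable_orbit_if_annihilated) (auto simp: complex_eigenvalue_def)
  ultimately show ?thesis by simp
qed

lemma linear_funpow_matrix:
  fixes L :: "real^'m^'m"
  shows "linear ((*v) L ^^ n)"
proof (induction n)
  case 0
  show ?case using linear_id by (simp add: id_def)
next
  case (Suc n)
  show ?case
    using linear_compose[OF Suc.IH matrix_vector_mul_linear[of L]] by (simp add: o_def)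
qed

text \<open>The operator norm of \<open>L\<^sup>n\<close> is at most the sum of the norms of \<open>L\<^sup>n b\<close> over the finitely many
  basis vectors \<open>b\<close>, which carries summability from single orbits to all vectors at once.\<close>

lemma summable_power_bound:
  fixes L :: "real^'m^'m"
  assumes "\<And>\<mu>. complex_eigenvalue L \<mu> \<Longrightarrow> cmod \<mu> < 1"
  obtains K where "summable K" and "\<And>n. 0 \<le> K n"
    and "\<And>n x. norm (((*v) L ^^ n) x) \<le> K n * norm x"
proof
  let ?K = "\<lambda>n. \<Sum>b\<in>Basis. norm (((*v) L ^^ n) b)"
  show "summable ?K"
    using assms by (intro summable_sum summable_real_orbit)
  show "0 \<le> ?K n" for n
    by (simp add: sum_nonneg)
  show "norm (((*v) L ^^ n) x) \<le> ?K n * norm x" for n x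
  proof -
    have "((*v) L ^^ n) x = ((*v) L ^^ n) (\<Sum>b\<in>Basis. (x \<bullet> b) *\<^sub>R b)"
      by (simp add: euclidean_representation)
    also have "\<dots> = (\<Sum>b\<in>Basis. (x \<bullet> b) *\<^sub>R ((*v) L ^^ n) b)"
      by (simp add: linear_sum[OF linear_funpow_matrix] linear_cmul[OF linear_funpow_matrix])
    finally have "norm (((*v) L ^^ n) x) \<le> (\<Sum>b\<in>Basis. \<bar>x \<bullet> b\<bar> * norm (((*v) L ^^ n) b))"
      using norm_sum[of "\<lambda>b. (x \<bullet> b) *\<^sub>R ((*v) L ^^ n) b" Basis] by simp
    also have "\<dots> \<le> (\<Sum>b\<in>Basis. norm x * norm (((*v) L ^^ n) b))"
      by (intro sum_mono mult_right_mono Basis_le_norm) auto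
    finally show ?thesis
      by (simp add: sum_distrib_left[symmetric] mult.commute)
  qed
qed


section \<open>Existence of a fixed set\<close>

lemma inflated_map_mono: "B \<subseteq> C \<Longrightarrow> inflated_map L \<epsilon> B \<subseteq> inflated_map L \<epsilon> C"
  unfolding inflated_map_def by blast

lemma inflated_map_UN:
  "inflated_map L \<epsilon> (\<Union>n. C n) = (\<Union>n. inflated_map L \<epsilon> (C n))"
  unfolding inflated_map_def by blast

text \<open>One inclusion holds because the inflated map sends compact sets to closed ones, the other
  because each map \<open>x \<mapsto> L x + y\<close> is continuous.\<close>

lemma inflated_map_closure:
  assumes "bounded C" and "C \<noteq> {}" and "\<epsilon> > 0"
  shows "inflated_map L \<epsilon> (closure C) = closure (inflated_map L \<epsilon> C)"
proof
  have "closure C \<in> \<K>"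
    using assms by (simp add: nonempty_compacts_def compact_closure)
  then have "closed (inflated_map L \<epsilon> (closure C))"
    using inflated_map_in_nonempty_compacts[of "closure C" \<epsilon> L] \<open>\<epsilon> > 0\<close>
    by (simp add: nonempty_compacts_def compact_imp_closed)
  then show "closure (inflated_map L \<epsilon> C) \<subseteq> inflated_map L \<epsilon> (closure C)"
    by (intro closure_minimal inflated_map_mono closure_subset)
  show "inflated_map L \<epsilon> (closure C) \<subseteq> closure (inflated_map L \<epsilon> C)"
  proof
    fix z assume "z \<in> inflated_map L \<epsilon> (closure C)"
    then obtain x y where "x \<in> closure C" and y: "norm y \<le> \<epsilon>" and z: "z = L *v x + y"
      by (rule inflated_mapE)
    have "(\<lambda>x. L *v x + y) ` closure C \<subseteq> closure ((\<lambda>x. L *v x + y) ` C)"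
      by (intro continuous_image_closure_subset[of UNIV] continuous_intros linear_continuous_on) auto
    also have "\<dots> \<subseteq> closure (inflated_map L \<epsilon> C)"
      using y by (intro closure_mono) (auto intro: inflated_mapI)
    finally show "z \<in> closure (inflated_map L \<epsilon> C)"
      using \<open>x \<in> closure C\<close> z by blast
  qed
qed

text \<open>For the induction to go through, one bounds all further images \<open>L\<^sup>k x\<close> and not just \<open>x\<close>
  itself: the points of the \<open>n\<close>-th iterate are the sums \<open>\<Sum>i<n. L\<^sup>i y\<^sub>i\<close> with \<open>\<parallel>y\<^sub>i\<parallel> \<le> \<epsilon>\<close>.\<close>

lemma inflated_map_iterates_of_0_bounded:
  assumes K: "\<And>n x. norm (((*v) L ^^ n) x) \<le> K n * norm x" "\<And>n. 0 \<le> K n"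
  shows "x \<in> (inflated_map L \<epsilon> ^^ n) {0} \<Longrightarrow> norm (((*v) L ^^ k) x) \<le> \<epsilon> * sum K {k..<k + n}"
proof (induction n arbitrary: x k)
  case 0
  then show ?case using K(1)[of k 0] by simp
next
  case (Suc n)
  then obtain x' y where x': "x' \<in> (inflated_map L \<epsilon> ^^ n) {0}" and y: "norm y \<le> \<epsilon>"
    and x: "x = L *v x' + y"
    by (auto elim: inflated_mapE)
  have "((*v) L ^^ k) x = ((*v) L ^^ Suc k) x' + ((*v) L ^^ k) y"
    by (simp add: x linear_add[OF linear_funpow_matrix] funpow_swap1)
  then have "norm (((*v) L ^^ k) x) \<le> norm (((*v) L ^^ Suc k) x') + norm (((*v) L ^^ k) y)"
    by (metis norm_triangle_ineq)
  also have "\<dots> \<le> \<epsilon> * sum K {Suc k..<Suc k + n} + K k * \<epsilon>"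
    using K(1)[of k y] mult_left_mono[OF y K(2)[of k]]
    by (intro add_mono Suc.IH x') linarith
  also have "\<dots> = \<epsilon> * sum K {k..<k + Suc n}"
    by (simp add: sum.atLeast_Suc_lessThan algebra_simps del: sum.op_ivl_Suc)
  finally show ?case .
qed

lemma fixed_set_exists:
  assumes "\<And>\<mu>. complex_eigenvalue L \<mu> \<Longrightarrow> cmod \<mu> < 1" and "\<epsilon> > 0"
  shows "\<exists>A\<in>\<K>. inflated_map L \<epsilon> A = A"
proof -
  obtain K where K: "summable K" "\<And>n. 0 \<le> K n" "\<And>n x. norm (((*v) L ^^ n) x) \<le> K n * norm x"
    using summable_power_bound[OF assms(1)] by metis
  define U where "U n = (inflated_map L \<epsilon> ^^ n) {0}" for n
  have U0: "U 0 \<subseteq> U (Suc 0)"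
    using inflated_mapI[of 0 "{0}" 0 \<epsilon> L] \<open>\<epsilon> > 0\<close> by (simp add: U_def)
  have "norm x \<le> \<epsilon> * suminf K" if "x \<in> U n" for x n
  proof -
    have "norm x \<le> \<epsilon> * sum K {0..<n}"
      using inflated_map_iterates_of_0_bounded[OF K(3,2), where k = 0 and n = n and x = x] that by (simp add: U_def)
    also have "\<dots> \<le> \<epsilon> * suminf K"
      using K \<open>\<epsilon> > 0\<close> by (intro mult_left_mono sum_le_suminf) auto
    finally show ?thesis .
  qed
  then have bdd: "bounded (\<Union>n. U n)"
    by (auto simp: bounded_iff)
  have ne: "(\<Union>n. U n) \<noteq> {}"
    by (auto simp: U_def intro!: exI[of _ 0])
  have "inflated_map L \<epsilon> (\<Union>n. U n) = (\<Union>n. U (Suc n))"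
    unfolding inflated_map_UN by (simp add: U_def)
  also have "\<dots> = (\<Union>n. U n)"
  proof (intro equalityI UN_least)
    show "U n \<subseteq> (\<Union>n. U (Suc n))" for n
      using U0 by (cases n) auto
  qed blast
  finally have "inflated_map L \<epsilon> (closure (\<Union>n. U n)) = closure (\<Union>n. U n)"
    using inflated_map_closure[OF bdd ne \<open>\<epsilon> > 0\<close>] by simp
  then show ?thesis
    using bdd ne by (intro bexI) (auto simp: nonempty_compacts_def compact_closure)
qed


section \<open>Uniqueness and global attraction\<close>

text \<open>Start at \<open>b\<close> and repeat the perturbations that lead from \<open>c\<close> to \<open>x\<close>: they cancel in the
  difference, on which only \<open>L\<close> acts.\<close>

lemma inflated_map_iterates_shadow:
  assumes "b \<in> B"
  shows "x \<in> (inflated_map L \<epsilon> ^^ n) C \<Longrightarrow>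
    \<exists>c\<in>C. \<exists>y\<in>(inflated_map L \<epsilon> ^^ n) B. x - y = ((*v) L ^^ n) (c - b)"
proof (induction n arbitrary: x)
  case 0
  then show ?case using assms by auto
next
  case (Suc n)
  then obtain x' z where x': "x' \<in> (inflated_map L \<epsilon> ^^ n) C" and z: "norm z \<le> \<epsilon>"
    and x: "x = L *v x' + z"
    by (auto elim: inflated_mapE)
  obtain c y' where "c \<in> C" and y': "y' \<in> (inflated_map L \<epsilon> ^^ n) B"
    and diff: "x' - y' = ((*v) L ^^ n) (c - b)"
    using Suc.IH[OF x'] by blast
  have "x - (L *v y' + z) = ((*v) L ^^ Suc n) (c - b)"
    by (simp add: x diff[symmetric] matrix_vector_mult_diff_distrib)
  moreover have "L *v y' + z \<in> (inflated_map L \<epsilon> ^^ Suc n) B"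
    using inflated_mapI[OF y' z] by simp
  ultimately show ?case
    using \<open>c \<in> C\<close> by blast
qed

text \<open>The lower bound also rests on \<open>r\<close>: it makes the suprema in the definition range over sets
  bounded above.\<close>

lemma hausdorff_dist_bounds:
  assumes "X \<noteq> {}" "Y \<noteq> {}"
    and "\<And>x. x \<in> X \<Longrightarrow> \<exists>y\<in>Y. dist x y \<le> r" and "\<And>y. y \<in> Y \<Longrightarrow> \<exists>x\<in>X. dist x y \<le> r"
  shows "0 \<le> hausdorff_dist X Y" and "hausdorff_dist X Y \<le> r"
proof -
  have INF: "(INF y\<in>Y. dist x y) \<in> {0..r}" if x: "x \<in> X" for x
  proof -
    obtain y where "y \<in> Y" "dist x y \<le> r" using assms(3)[OF x] by blast
    moreover have "bdd_below (dist x ` Y)"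
      by (rule bdd_belowI2[where m = 0]) simp
    ultimately have le: "(INF y\<in>Y. dist x y) \<le> r"
      using cINF_lower2[of "dist x" Y y r] by blast
    have "0 \<le> (INF y\<in>Y. dist x y)"
      using assms(2) by (rule cINF_greatest) simp
    then show ?thesis using le by simp
  qed
  have INF': "(INF x\<in>X. dist x y) \<in> {0..r}" if y: "y \<in> Y" for y
  proof -
    obtain x where "x \<in> X" "dist x y \<le> r" using assms(4)[OF y] by blast
    moreover have "bdd_below ((\<lambda>x. dist x y) ` X)"
      by (rule bdd_belowI2[where m = 0]) simp
    ultimately have le: "(INF x\<in>X. dist x y) \<le> r"
      using cINF_lower2[of "\<lambda>x. dist x y" X x r] by blast
    have "0 \<le> (INF x\<in>X. dist x y)"
      using assms(1) by (rule cINF_greatest) simp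
    then show ?thesis using le by simp
  qed
  have "(SUP x\<in>X. INF y\<in>Y. dist x y) \<le> r"
    using INF by (intro cSUP_least assms(1)) simp
  moreover have "(SUP y\<in>Y. INF x\<in>X. dist x y) \<le> r"
    using INF' by (intro cSUP_least assms(2)) simp
  ultimately show "hausdorff_dist X Y \<le> r"
    by (simp add: hausdorff_dist_def)
  obtain x where "x \<in> X" using assms(1) by blast
  moreover have "bdd_above ((\<lambda>x. INF y\<in>Y. dist x y) ` X)"
    using INF by (intro bdd_aboveI2[where M = r]) simp
  ultimately have "(INF y\<in>Y. dist x y) \<le> (SUP x\<in>X. INF y\<in>Y. dist x y)"
    by (rule cSUP_upper)
  then have "0 \<le> (SUP x\<in>X. INF y\<in>Y. dist x y)"
    using INF[OF \<open>x \<in> X\<close>] by simp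
  then show "0 \<le> hausdorff_dist X Y"
    by (simp add: hausdorff_dist_def)
qed

text \<open>Shadowing from a single point \<open>b\<close> of \<open>B\<close> suffices, so that any bound on the distances from \<open>b\<close>
  to the points of \<open>C\<close> can be taken for \<open>D\<close>, independently of \<open>n\<close>.\<close>

lemma inflated_map_iterates_near:
  assumes K: "\<And>n x. norm (((*v) L ^^ n) x) \<le> K n * norm x" "\<And>n. 0 \<le> K n"
    and "B \<in> \<K>" "C \<in> \<K>"
  obtains D where "\<And>n x. x \<in> (inflated_map L \<epsilon> ^^ n) C \<Longrightarrow>
    \<exists>y\<in>(inflated_map L \<epsilon> ^^ n) B. dist x y \<le> K n * D"
proof -
  obtain b where "b \<in> B" using assms(3) by (auto simp: nonempty_compacts_def)
  obtain D where D: "\<And>c. c \<in> C \<Longrightarrow> dist b c \<le> D"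
    using compact_imp_bounded[of C] assms(4) bounded_any_center[of C b]
    by (auto simp: nonempty_compacts_def)
  show thesis
  proof
    fix n x assume "x \<in> (inflated_map L \<epsilon> ^^ n) C"
    then obtain c y where "c \<in> C" and y: "y \<in> (inflated_map L \<epsilon> ^^ n) B"
      and diff: "x - y = ((*v) L ^^ n) (c - b)"
      using inflated_map_iterates_shadow[OF \<open>b \<in> B\<close>] by blast
    have "dist x y \<le> K n * norm (c - b)"
      unfolding dist_norm diff by (rule K(1))
    also have "\<dots> \<le> K n * D"
      using D[OF \<open>c \<in> C\<close>] K(2) by (intro mult_left_mono) (auto simp: dist_norm norm_minus_commute)
    finally show "\<exists>y\<in>(inflated_map L \<epsilon> ^^ n) B. dist x y \<le> K n * D"
      using y by blast
  qed
qed

lemma funpow_fixed: "f a = a \<Longrightarrow> (f ^^ n) a = a"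
  by (induction n) simp_all

lemma fixed_set_subset:
  assumes K: "\<And>n x. norm (((*v) L ^^ n) x) \<le> K n * norm x" "\<And>n. 0 \<le> K n" "K \<longlonglongrightarrow> 0"
    and A: "A \<in> \<K>" "inflated_map L \<epsilon> A = A" and B: "B \<in> \<K>" "inflated_map L \<epsilon> B = B"
  shows "B \<subseteq> A"
proof
  fix x assume "x \<in> B"
  obtain D where D: "\<And>n x. x \<in> (inflated_map L \<epsilon> ^^ n) B \<Longrightarrow>
    \<exists>y\<in>(inflated_map L \<epsilon> ^^ n) A. dist x y \<le> K n * D"
    using inflated_map_iterates_near[OF K(1,2) A(1) B(1)] by blast
  have "infdist x A \<le> K n * D" for n
  proof -
    obtain y where "y \<in> A" "dist x y \<le> K n * D"
      using D[of x n] \<open>x \<in> B\<close> by (auto simp: funpow_fixed[of "inflated_map L \<epsilon>"] A B)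
    then show ?thesis by (metis infdist_le2)
  qed
  moreover have "(\<lambda>n. K n * D) \<longlonglongrightarrow> 0"
    using tendsto_mult_right[OF K(3), of D] by simp
  ultimately have "infdist x A \<le> 0"
    by (intro LIMSEQ_le_const) auto
  then have "infdist x A = 0"
    using infdist_nonneg[of x A] by simp
  then show "x \<in> A"
    using A(1) in_closed_iff_infdist_zero[of A x]
    by (auto simp: nonempty_compacts_def compact_imp_closed)
qed

lemma fixed_set_globally_attracting:
  assumes K: "\<And>n x. norm (((*v) L ^^ n) x) \<le> K n * norm x" "\<And>n. 0 \<le> K n" "K \<longlonglongrightarrow> 0"
    and A: "A \<in> \<K>" "inflated_map L \<epsilon> A = A" and "\<epsilon> > 0"
  shows "globally_attracting (inflated_map L \<epsilon>) A"
  unfolding globally_attracting_def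
proof
  fix C :: "(real^'a) set" assume C: "C \<in> \<K>"
  let ?F = "inflated_map L \<epsilon>"
  have FA: "(?F ^^ n) A = A" for n
    using A(2) by (rule funpow_fixed)
  have FC: "(?F ^^ n) C \<in> \<K>" for n
    by (induction n) (simp_all add: C inflated_map_in_nonempty_compacts \<open>\<epsilon> > 0\<close>)
  obtain D where D: "\<And>n x. x \<in> (?F ^^ n) C \<Longrightarrow> \<exists>y\<in>(?F ^^ n) A. dist x y \<le> K n * D"
    using inflated_map_iterates_near[OF K(1,2) A(1) C] by blast
  obtain D' where D': "\<And>n x. x \<in> (?F ^^ n) A \<Longrightarrow> \<exists>y\<in>(?F ^^ n) C. dist x y \<le> K n * D'"
    using inflated_map_iterates_near[OF K(1,2) C A(1)] by blast
  let ?r = "\<lambda>n. K n * max D D'"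
  have le: "K n * D \<le> ?r n" "K n * D' \<le> ?r n" for n
    using K(2) by (simp_all add: mult_left_mono)
  have h: "0 \<le> hausdorff_dist ((?F ^^ n) C) A \<and> hausdorff_dist ((?F ^^ n) C) A \<le> ?r n" for n
  proof -
    have "(?F ^^ n) C \<noteq> {}" "A \<noteq> {}"
      using FC A(1) by (auto simp: nonempty_compacts_def)
    moreover have "\<exists>y\<in>A. dist x y \<le> ?r n" if "x \<in> (?F ^^ n) C" for x
      using D[OF that] le(1)[of n] unfolding FA by (meson order_trans)
    moreover have "\<exists>x\<in>(?F ^^ n) C. dist x y \<le> ?r n" if "y \<in> A" for y
      using D'[of y n] that le(2)[of n] unfolding FA by (metis dist_commute order_trans)
    ultimately show ?thesis
      using hausdorff_dist_bounds[of "(?F ^^ n) C" A "?r n"] by blast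
  qed
  have "?r \<longlonglongrightarrow> 0"
    using tendsto_mult_right[OF K(3), of "max D D'"] by simp
  then show "(\<lambda>n. hausdorff_dist ((?F ^^ n) C) A) \<longlonglongrightarrow> 0"
    by (rule tendsto_sandwich[OF _ _ tendsto_const, rotated 2]) (use h in auto)
qed

theorem proposition2p2:
  fixes L :: "real^'m^'m" and \<epsilon> :: real
  assumes "invertible L" and "\<epsilon> > 0"
  shows "((\<exists>A\<in>\<K>. inflated_map L \<epsilon> A = A) \<longleftrightarrow>
            (\<forall>\<mu>. complex_eigenvalue L \<mu> \<longrightarrow> cmod \<mu> < 1)) \<and>
         (\<forall>A\<in>\<K>. inflated_map L \<epsilon> A = A \<longrightarrow>
            (\<forall>B\<in>\<K>. inflated_map L \<epsilon> B = B \<longrightarrow> B = A) \<and>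
            globally_attracting (inflated_map L \<epsilon>) A)"
proof (intro conjI ballI impI)
  show "(\<exists>A\<in>\<K>. inflated_map L \<epsilon> A = A) \<longleftrightarrow> (\<forall>\<mu>. complex_eigenvalue L \<mu> \<longrightarrow> cmod \<mu> < 1)"
  proof (intro iffI allI impI)
    fix \<mu>
    assume "\<exists>A\<in>\<K>. inflated_map L \<epsilon> A = A" and \<mu>: "complex_eigenvalue L \<mu>"
    then obtain A where "A \<in> \<K>" "inflated_map L \<epsilon> A = A" by blast
    then show "cmod \<mu> < 1"
      using \<open>\<epsilon> > 0\<close> \<mu> by (rule eigenvalue_less_1_if_fixed_set)
  next
    assume eig: "\<forall>\<mu>. complex_eigenvalue L \<mu> \<longrightarrow> cmod \<mu> < 1"
    show "\<exists>A\<in>\<K>. inflated_map L \<epsilon> A = A"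
      by (rule fixed_set_exists[OF _ \<open>\<epsilon> > 0\<close>]) (simp add: eig)
  qed
next
  fix A assume A: "A \<in> \<K>" "inflated_map L \<epsilon> A = A"
  have "\<And>\<mu>. complex_eigenvalue L \<mu> \<Longrightarrow> cmod \<mu> < 1"
    by (rule eigenvalue_less_1_if_fixed_set[OF A \<open>\<epsilon> > 0\<close>])
  then obtain K where "summable K" and K: "\<And>n x. norm (((*v) L ^^ n) x) \<le> K n * norm x"
      "\<And>n. 0 \<le> K n"
    using summable_power_bound by metis
  then have "K \<longlonglongrightarrow> 0" by (simp add: summable_LIMSEQ_zero)
  show "globally_attracting (inflated_map L \<epsilon>) A"
    by (rule fixed_set_globally_attracting[OF K \<open>K \<longlonglongrightarrow> 0\<close> A \<open>\<epsilon> > 0\<close>])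
  fix B assume B: "B \<in> \<K>" "inflated_map L \<epsilon> B = B"
  show "B = A"
    using fixed_set_subset[OF K \<open>K \<longlonglongrightarrow> 0\<close> A B] fixed_set_subset[OF K \<open>K \<longlonglongrightarrow> 0\<close> B A]
    by (rule equalityI)
qed

end
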